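(* For every $\epsilon>0$ there is an $N_\epsilon$ such that for each Player 2 strategy $g$ in the binary sequence game, there is a $g$-computable sequence $e_1e_3e_5\dots$ of Player 1 moves such that, when it is played against $g$, any two adjacent blocks of length $n>N_\epsilon$ in the resulting sequence $a_1a_2a_3\dots$ differ in at least $n(\frac14-\epsilon)$ many entries. That is, for each $k\ge1$ and $n>N_\epsilon$, $a_{k+s}\ne a_{k+n+s}$ for at least $n(\frac14-\epsilon)$ many $s$ with $0\le s<n$.
   Context: In the binary sequence game two players alternately choose bits, generating an infinite binary sequence $a_1a_2a_3a_4\dots=e_1d_2e_3d_4\dots$; Player 1 chooses the odd-indexed bits $e_{2i+1}$ and Player 2 the even-indexed bits $d_{2i}$, each with knowledge of all preceding bits but not future bits. A Player 2 strategy is a function $g$ from finite sequences of Player 1 moves to $\{0,1\}$; playing $e_1e_3e_5\dots$ against $g$ means $d_{2i}=g(e_1,e_3,\dots,e_{2i-1})$ for all $i\ge1$. "$g$-computable" means computable relative to the oracle $g$. *)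

theory Defs
  imports Complex_Main "HOL-Library.Nat_Bijection"
begin

section \<open>Computability relative to an oracle\<close>

text \<open>
  Kleene's partial recursive functions relative to an oracle \<open>orc\<close>: programs built from zero,
  successor, projections and the oracle by composition, primitive recursion and minimization.
  Arguments are passed as a list. Programs carry no arity; applying one to an argument list of
  unsuitable length simply yields no result.
\<close>

datatype recf =
    Zero
  | Succ
  | Proj nat
  | Oracle
  | Comp recf "recf list"
  | PrimRec recf recf
  | Mu recf

text \<open>
  \<open>computes orc p xs y\<close>: program \<open>p\<close> with oracle \<open>orc\<close> halts on the arguments \<open>xs\<close> with
  output \<open>y\<close>. Minimization requires convergence at all smaller arguments.
\<close>

inductive computes :: "(nat \<Rightarrow> nat) \<Rightarrow> recf \<Rightarrow> nat list \<Rightarrow> nat \<Rightarrow> bool"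
  for orc :: "nat \<Rightarrow> nat" where
  Zero: "computes orc Zero xs 0"
| Succ: "computes orc Succ [x] (Suc x)"
| Proj: "i < length xs \<Longrightarrow> computes orc (Proj i) xs (xs ! i)"
| Oracle: "computes orc Oracle [x] (orc x)"
| Comp: "list_all2 (\<lambda>q y. computes orc q xs y) qs ys \<Longrightarrow> computes orc p ys z
    \<Longrightarrow> computes orc (Comp p qs) xs z"
| PrimRec_0: "computes orc p xs z \<Longrightarrow> computes orc (PrimRec p q) (0 # xs) z"
| PrimRec_Suc: "computes orc (PrimRec p q) (n # xs) r \<Longrightarrow> computes orc q (n # r # xs) z
    \<Longrightarrow> computes orc (PrimRec p q) (Suc n # xs) z"
| Mu: "computes orc p (y # xs) 0 \<Longrightarrow> (\<forall>i<y. \<exists>z. computes orc p (i # xs) (Suc z))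
    \<Longrightarrow> computes orc (Mu p) xs y"

inductive_cases computes_elims:
  "computes orc Zero xs y"
  "computes orc Succ xs y"
  "computes orc (Proj i) xs y"
  "computes orc Oracle xs y"
  "computes orc (Comp p qs) xs y"
  "computes orc (PrimRec p q) (0 # xs) y"
  "computes orc (PrimRec p q) (Suc n # xs) y"
  "computes orc (Mu p) xs y"

lemma computes_deterministic:
  "computes orc p xs y \<Longrightarrow> computes orc p xs y' \<Longrightarrow> y = y'"
proof (induction arbitrary: y' rule: computes.induct)
  case (Comp xs qs ys p z)
  obtain ys' where l: "list_all2 (\<lambda>q y. computes orc q xs y) qs ys'"
    and z: "computes orc p ys' y'"
    using computes_elims(5)[OF Comp.prems] by metis
  have "ys = ys'"
    using Comp.IH(1) l by (simp add: list_all2_conv_all_nth list_eq_iff_nth_eq)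
  with Comp.IH(2) z show ?case by blast
next
  case (PrimRec_Suc p q n xs r z)
  show ?case
    by (rule computes_elims(7)[OF PrimRec_Suc.prems]) (metis PrimRec_Suc.IH)
next
  case (Mu p y xs)
  have 1: "computes orc p (y' # xs) 0"
    and 2: "\<forall>i<y'. \<exists>z. computes orc p (i # xs) (Suc z)"
    using computes_elims(8)[OF Mu.prems] by metis+
  have "\<not> y < y'" using Mu.IH(1) 2 by (metis nat.distinct(1))
  moreover have "\<not> y' < y" using Mu.IH(2) 1 by (metis nat.distinct(1))
  ultimately show ?case by simp
qed (blast elim: computes_elims)+

definition recursive_in :: "(nat \<Rightarrow> nat) \<Rightarrow> (nat \<Rightarrow> nat) \<Rightarrow> bool" where
  "recursive_in orc f \<longleftrightarrow> (\<exists>p. \<forall>n. computes orc p [n] (f n))"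

section \<open>The binary sequence game\<close>

text \<open>
  Bits are of type \<open>bool\<close>, and a Player 2 strategy is a function from finite sequences of
  Player 1 moves to bits. It becomes a number-theoretic oracle via the standard coding of lists:
  on the code of a 0-1-list \<open>es\<close> the oracle returns \<open>g es\<close>. On codes of other lists, nonzero
  entries are read as 1.
\<close>

type_synonym strategy = "bool list \<Rightarrow> bool"

definition strategy_oracle :: "strategy \<Rightarrow> nat \<Rightarrow> nat" where
  "strategy_oracle g m = of_bool (g (map (\<lambda>x. x \<noteq> 0) (list_decode m)))"

text \<open>
  Sequences of Player 1 moves are indexed so that \<open>e i\<close> is the move $e_{2i+1}$.
\<close>

definition computable_from :: "strategy \<Rightarrow> (nat \<Rightarrow> bool) \<Rightarrow> bool" where
  "computable_from g e \<longleftrightarrow> recursive_in (strategy_oracle g) (\<lambda>i. of_bool (e i))"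

text \<open>
  \<open>play g e j\<close> is the bit $a_j$ when \<open>e\<close> is played against \<open>g\<close>: $a_{2i+1} = e_{2i+1}$ and
  $a_{2i} = g(e_1, e_3, \ldots, e_{2i-1})$. Only indices \<open>j \<ge> 1\<close> are meaningful.
\<close>

definition play :: "strategy \<Rightarrow> (nat \<Rightarrow> bool) \<Rightarrow> nat \<Rightarrow> bool" where
  "play g e j = (if odd j then e (j div 2) else g (map e [0..<j div 2]))"

end

theory Submission
  imports Defs "HOL-Real_Asymp.Real_Asymp"
begin

text \<open>
  Player 1 defeats, for every shift \<open>n\<close> at once, the expert who predicts that the next move repeats
  the bit played \<open>n\<close> steps earlier. For every starting time \<open>j\<close> and shift \<open>n\<close> keep a weight, born with the
  value \<open>R ^ n\<close> for some \<open>R < 1\<close> and multiplied at each move by \<open>B / C > 1\<close> on a match and by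
  \<open>A / C < 1\<close> on a mismatch, and let Player 1 play against the weighted majority. As the
  average of the two factors is below 1, the total weight shrinks geometrically up to the bounded
  weight of the newborn experts, so it stays bounded. If two adjacent blocks of large length \<open>n\<close>
  differed too little, then they would differ in fewer than about half of the roughly \<open>n / 2\<close> positions of
  Player 1 in the second block, and the weight of shift \<open>n\<close> would exceed the bound. Each
  decision compares finitely many integers computed from the past, so the strategy is computable
  from \<open>g\<close>. Only Player 1's positions are used, which accounts for \<open>1/4\<close>.
\<close>

section \<open>Closure properties of relative computability\<close>

definition computable :: "(nat \<Rightarrow> nat) \<Rightarrow> nat \<Rightarrow> (nat list \<Rightarrow> nat) \<Rightarrow> bool" where
  "computable orc k f \<longleftrightarrow> (\<exists>p. \<forall>xs. length xs = k \<longrightarrow> computes orc p xs (f xs))"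

named_theorems computable_intros

lemma computable_cong:
  assumes "computable orc k f" "\<And>xs. length xs = k \<Longrightarrow> f xs = f' xs"
  shows "computable orc k f'"
  using assms unfolding computable_def by metis

lemma computable_comp:
  assumes h: "computable orc (length fs) h" and fs: "\<And>f. f \<in> set fs \<Longrightarrow> computable orc k f"
  shows "computable orc k (\<lambda>xs. h (map (\<lambda>f. f xs) fs))"
proof -
  from h obtain p where p: "\<And>ys. length ys = length fs \<Longrightarrow> computes orc p ys (h ys)"
    unfolding computable_def by blast
  from fs obtain P where P: "\<And>f xs. f \<in> set fs \<Longrightarrow> length xs = k \<Longrightarrow> computes orc (P f) xs (f xs)"
    unfolding computable_def by metis
  have "computes orc (Comp p (map P fs)) xs (h (map (\<lambda>f. f xs) fs))" if "length xs = k" for xs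
    by (rule computes.Comp[where ys = "map (\<lambda>f. f xs) fs"])
      (use P p that in \<open>auto simp: list_all2_conv_all_nth\<close>)
  then show ?thesis
    unfolding computable_def by blast
qed

text \<open>Lifts \<open>F\<close> from a bare projection to any computable argument, so that a
  closure rule need only be checked on projections.\<close>

lemma computable_comp1:
  assumes "computable orc 1 (\<lambda>ys. F (ys ! 0))" "computable orc k a"
  shows "computable orc k (\<lambda>xs. F (a xs))"
  using computable_comp[of orc "[a]" "\<lambda>ys. F (ys ! 0)" k] assms by simp

lemma computable_comp2:
  assumes "computable orc 2 (\<lambda>ys. F (ys ! 0) (ys ! 1))" "computable orc k a" "computable orc k b"
  shows "computable orc k (\<lambda>xs. F (a xs) (b xs))"
  using computable_comp[of orc "[a, b]" "\<lambda>ys. F (ys ! 0) (ys ! 1)" k] assms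
  by (auto simp: numeral_2_eq_2)

lemma computable_comp3:
  assumes "computable orc 3 (\<lambda>ys. F (ys ! 0) (ys ! 1) (ys ! 2))"
    "computable orc k a" "computable orc k b" "computable orc k c"
  shows "computable orc k (\<lambda>xs. F (a xs) (b xs) (c xs))"
  using computable_comp[of orc "[a, b, c]" "\<lambda>ys. F (ys ! 0) (ys ! 1) (ys ! 2)" k] assms
  by (auto simp: numeral_2_eq_2 numeral_3_eq_3)

lemma computable_nth [computable_intros]: "i < k \<Longrightarrow> computable orc k (\<lambda>xs. xs ! i)"
  unfolding computable_def by (metis computes.Proj)

text \<open>In the step of a primitive recursion the parameters sit behind the counter and the
  previous value; this rule reaches them.\<close>

lemma computable_nth_tl_tl [computable_intros]:
  assumes "i + 2 < k"
  shows "computable orc k (\<lambda>xs. tl (tl xs) ! i)"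
proof (rule computable_cong)
  show "computable orc k (\<lambda>xs. xs ! Suc (Suc i))"
    using assms by (intro computable_nth) simp
qed (use assms in \<open>simp add: nth_tl\<close>)

lemma computable_Suc [computable_intros]:
  assumes "computable orc k a"
  shows "computable orc k (\<lambda>xs. Suc (a xs))"
proof (rule computable_comp1[OF _ assms])
  show "computable orc 1 (\<lambda>ys. Suc (ys ! 0))"
    unfolding computable_def by (metis computes.Succ One_nat_def length_0_conv length_Suc_conv nth_Cons_0)
qed

lemma computable_oracle [computable_intros]:
  assumes "computable orc k a"
  shows "computable orc k (\<lambda>xs. orc (a xs))"
proof (rule computable_comp1[OF _ assms])
  show "computable orc 1 (\<lambda>ys. orc (ys ! 0))"
    unfolding computable_def by (metis computes.Oracle One_nat_def length_0_conv length_Suc_conv nth_Cons_0)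
qed

lemma computable_const [computable_intros]: "computable orc k (\<lambda>_. c)"
proof (induction c)
  case 0
  show ?case
    unfolding computable_def by (metis computes.Zero)
qed (rule computable_Suc)

lemma computable_rec_nat [computable_intros]:
  assumes a: "computable orc k a"
    and s: "computable orc (Suc (Suc k)) (\<lambda>ys. S (ys ! 0) (ys ! 1) (tl (tl ys)))"
    and b: "computable orc k b"
  shows "computable orc k (\<lambda>xs. rec_nat (a xs) (\<lambda>n r. S n r xs) (b xs))"
proof -
  obtain p where p: "\<And>xs. length xs = k \<Longrightarrow> computes orc p xs (a xs)"
    using a unfolding computable_def by blast
  obtain q where q: "\<And>ys. length ys = Suc (Suc k) \<Longrightarrow>
      computes orc q ys (S (ys ! 0) (ys ! 1) (tl (tl ys)))"
    using s unfolding computable_def by blast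
  have "computes orc (PrimRec p q) (n # xs) (rec_nat (a xs) (\<lambda>n r. S n r xs) n)"
    if "length xs = k" for n xs
  proof (induction n)
    case 0
    show ?case
      using computes.PrimRec_0[OF p[OF that]] by simp
  next
    case (Suc n)
    show ?case
      using computes.PrimRec_Suc[OF Suc q[of "n # _ # xs"]] that by simp
  qed
  then have "computes orc (PrimRec p q) ys (rec_nat (a (tl ys)) (\<lambda>n r. S n r (tl ys)) (hd ys))"
    if "length ys = Suc k" for ys
    using that by (cases ys) auto
  then have "computable orc (Suc k) (\<lambda>ys. rec_nat (a (tl ys)) (\<lambda>n r. S n r (tl ys)) (hd ys))"
    unfolding computable_def by blast
  \<comment> \<open>Composing with \<open>b\<close> followed by all \<open>k\<close> projections
    rebuilds the argument list that \<open>PrimRec\<close> expects.\<close>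
  then have "computable orc k (\<lambda>xs. (\<lambda>ys. rec_nat (a (tl ys)) (\<lambda>n r. S n r (tl ys)) (hd ys))
      (map (\<lambda>f. f xs) (b # map (\<lambda>i xs. xs ! i) [0..<k])))"
    by (intro computable_comp) (auto intro: b computable_nth)
  then show ?thesis
  proof (rule computable_cong)
    fix xs :: "nat list"
    assume "length xs = k"
    then have "map ((\<lambda>f. f xs) \<circ> (\<lambda>i xs. xs ! i)) [0..<k] = xs"
      by (auto simp: comp_def map_nth)
    then show "rec_nat (a (tl (map (\<lambda>f. f xs) (b # map (\<lambda>i xs. xs ! i) [0..<k]))))
        (\<lambda>n r. S n r (tl (map (\<lambda>f. f xs) (b # map (\<lambda>i xs. xs ! i) [0..<k]))))
        (hd (map (\<lambda>f. f xs) (b # map (\<lambda>i xs. xs ! i) [0..<k])))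
      = rec_nat (a xs) (\<lambda>n r. S n r xs) (b xs)"
      by simp
  qed
qed

lemma computable_add [computable_intros]:
  assumes "computable orc k a" "computable orc k b"
  shows "computable orc k (\<lambda>xs. a xs + b xs)"
proof -
  have "rec_nat m (\<lambda>_ r. Suc r) n = m + n" for m n
    by (induction n) auto
  moreover have "computable orc 2 (\<lambda>ys. rec_nat (ys ! 0) (\<lambda>_ r. Suc r) (ys ! 1))"
    by (intro computable_intros) auto
  ultimately have "computable orc 2 (\<lambda>ys. ys ! 0 + ys ! 1)"
    by (simp only:)
  from computable_comp2[of orc "(+)", OF this assms] show ?thesis .
qed

lemma computable_mult [computable_intros]:
  assumes "computable orc k a" "computable orc k b"
  shows "computable orc k (\<lambda>xs. a xs * b xs)"
proof -
  have "rec_nat 0 (\<lambda>_ r. r + m) n = m * n" for m n :: nat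
    by (induction n) auto
  moreover have "computable orc 2 (\<lambda>ys. rec_nat 0 (\<lambda>_ r. r + ys ! 0) (ys ! 1))"
    by (intro computable_intros) auto
  ultimately have "computable orc 2 (\<lambda>ys. ys ! 0 * ys ! 1)"
    by (simp only:)
  from computable_comp2[of orc "(*)", OF this assms] show ?thesis .
qed

lemma computable_power [computable_intros]:
  assumes "computable orc k a" "computable orc k b"
  shows "computable orc k (\<lambda>xs. a xs ^ b xs)"
proof -
  have "rec_nat (Suc 0) (\<lambda>_ r. r * m) n = m ^ n" for m n :: nat
    by (induction n) auto
  moreover have "computable orc 2 (\<lambda>ys. rec_nat (Suc 0) (\<lambda>_ r. r * ys ! 0) (ys ! 1))"
    by (intro computable_intros) auto
  ultimately have "computable orc 2 (\<lambda>ys. ys ! 0 ^ ys ! 1)"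
    by (simp only:)
  from computable_comp2[of orc "(^)", OF this assms] show ?thesis .
qed

lemma computable_diff [computable_intros]:
  assumes "computable orc k a" "computable orc k b"
  shows "computable orc k (\<lambda>xs. a xs - b xs)"
proof -
  \<comment> \<open>Predecessor is the recursion that returns its counter; iterating it gives
    truncated subtraction.\<close>
  have pred: "rec_nat 0 (\<lambda>n _. n) m = m - 1" for m
    by (induction m) auto
  have "computable orc 1 (\<lambda>ys. rec_nat 0 (\<lambda>n _. n) (ys ! 0))"
    by (intro computable_intros) auto
  then have [computable_intros]: "computable orc k (\<lambda>xs. a xs - 1)" if "computable orc k a" for k a
    using computable_comp1[of orc "\<lambda>m. m - 1"] that unfolding pred by blast
  have "rec_nat m (\<lambda>_ r. r - 1) n = m - n" for m n :: nat
    by (induction n) auto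
  moreover have "computable orc 2 (\<lambda>ys. rec_nat (ys ! 0) (\<lambda>_ r. r - 1) (ys ! 1))"
    by (intro computable_intros) auto
  ultimately have "computable orc 2 (\<lambda>ys. ys ! 0 - ys ! 1)"
    by (simp only:)
  from computable_comp2[of orc "(-)", OF this assms] show ?thesis .
qed

lemma computable_sum [computable_intros]:
  assumes "computable orc (Suc (Suc k)) (\<lambda>ys. F (ys ! 0) (tl (tl ys)))" "computable orc k b"
  shows "computable orc k (\<lambda>xs. \<Sum>n<b xs. F n xs)"
proof -
  have eq: "rec_nat 0 (\<lambda>n r. r + f n) m = (\<Sum>n<m. f n)" for m and f :: "nat \<Rightarrow> nat"
    by (induction m) auto
  have "computable orc k (\<lambda>xs. rec_nat 0 (\<lambda>n r. r + F n xs) (b xs))"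
    by (intro computable_intros assms) auto
  then show ?thesis
    by (simp add: eq)
qed

section \<open>Decidable predicates, binary digits and pairing\<close>

definition decidable :: "(nat \<Rightarrow> nat) \<Rightarrow> nat \<Rightarrow> (nat list \<Rightarrow> bool) \<Rightarrow> bool" where
  "decidable orc k P \<longleftrightarrow> computable orc k (\<lambda>xs. of_bool (P xs))"

lemma computable_of_bool [computable_intros]:
  "decidable orc k P \<Longrightarrow> computable orc k (\<lambda>xs. of_bool (P xs))"
  unfolding decidable_def .

lemma decidable_const [computable_intros]: "decidable orc k (\<lambda>_. P)"
  unfolding decidable_def by (rule computable_const)

lemma decidable_le [computable_intros]:
  assumes "computable orc k a" "computable orc k b"
  shows "decidable orc k (\<lambda>xs. a xs \<le> b xs)"
proof -
  have "of_bool (m \<le> n) = 1 - (m - n)" for m n :: nat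
    by auto
  then show ?thesis
    unfolding decidable_def using assms by (simp only:) (intro computable_intros)
qed

lemma computable_if [computable_intros]:
  assumes "decidable orc k P" "computable orc k a" "computable orc k b"
  shows "computable orc k (\<lambda>xs. if P xs then a xs else b xs)"
proof -
  have "(if Q then m else n) = of_bool Q * m + (1 - of_bool Q) * n" for Q and m n :: nat
    by simp
  then show ?thesis
    using assms by (simp only:) (intro computable_intros)
qed

lemma decidable_if [computable_intros]:
  assumes "decidable orc k P" "decidable orc k Q" "decidable orc k R"
  shows "decidable orc k (\<lambda>xs. if P xs then Q xs else R xs)"
proof -
  have "of_bool (if A then B else C) = (if A then of_bool B else (of_bool C :: nat))" for A B C
    by simp
  then show ?thesis
    unfolding decidable_def using assms by (simp only:) (intro computable_intros)
qed

lemma decidable_not [computable_intros]: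
  assumes "decidable orc k P"
  shows "decidable orc k (\<lambda>xs. \<not> P xs)"
proof -
  have "of_bool (\<not> Q) = (1 :: nat) - of_bool Q" for Q
    by simp
  then show ?thesis
    unfolding decidable_def using assms by (simp only:) (intro computable_intros)
qed

lemma decidable_iff [computable_intros]:
  assumes "decidable orc k P" "decidable orc k Q"
  shows "decidable orc k (\<lambda>xs. P xs = Q xs)"
proof -
  have "(A = B) = (if A then B else \<not> B)" for A B
    by simp
  then show ?thesis
    using assms by (simp only:) (intro computable_intros)
qed

lemma decidable_odd [computable_intros]:
  assumes "computable orc k a"
  shows "decidable orc k (\<lambda>xs. odd (a xs))"
proof -
  have "rec_nat 0 (\<lambda>_ r. 1 - r) n = (of_bool (odd n) :: nat)" for n
    by (induction n) auto
  moreover have "computable orc 1 (\<lambda>ys. rec_nat 0 (\<lambda>_ r. 1 - r) (ys ! 0))"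
    by (intro computable_intros) auto
  ultimately have "computable orc 1 (\<lambda>ys. of_bool (odd (ys ! 0)))"
    by (simp only:)
  from computable_comp1[of orc "\<lambda>n. of_bool (odd n)", OF this assms] show ?thesis
    unfolding decidable_def .
qed

lemma computable_div2 [computable_intros]:
  assumes "computable orc k a"
  shows "computable orc k (\<lambda>xs. a xs div 2)"
proof -
  have "rec_nat 0 (\<lambda>n r. r + of_bool (odd n)) n = n div 2" for n
    by (induction n) auto
  moreover have "computable orc 1 (\<lambda>ys. rec_nat 0 (\<lambda>n r. r + of_bool (odd n)) (ys ! 0))"
    by (intro computable_intros) auto
  ultimately have "computable orc 1 (\<lambda>ys. ys ! 0 div 2)"
    by (simp only:)
  from computable_comp1[of orc "\<lambda>n. n div 2", OF this assms] show ?thesis .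
qed

text \<open>Digit \<open>n\<close> is the parity left after \<open>n\<close> halvings.\<close>

lemma decidable_bit [computable_intros]:
  assumes "computable orc k a" "computable orc k b"
  shows "decidable orc k (\<lambda>xs. bit (a xs) (b xs))"
proof -
  have "rec_nat m (\<lambda>_ r. r div 2) n = m div 2 ^ n" for m n :: nat
    by (induction n) (auto simp: div_mult2_eq[symmetric] mult.commute)
  then have eq: "bit m n \<longleftrightarrow> odd (rec_nat m (\<lambda>_ r. r div 2) n)" for m n :: nat
    by (simp add: bit_iff_odd)
  have "computable orc 2 (\<lambda>ys. of_bool (odd (rec_nat (ys ! 0) (\<lambda>_ r. r div 2) (ys ! 1))))"
    by (intro computable_intros) auto
  from computable_comp2[of orc "\<lambda>m n. of_bool (odd (rec_nat m (\<lambda>_ r. r div 2) n))", OF this assms]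
  show ?thesis
    unfolding decidable_def eq .
qed

lemma computable_prod_encode [computable_intros]:
  assumes "computable orc k a" "computable orc k b"
  shows "computable orc k (\<lambda>xs. prod_encode (a xs, b xs))"
  unfolding prod_encode_def triangle_def prod.case by (intro computable_intros assms)

section \<open>The greedy strategy\<close>

text \<open>
  \<open>weight A B C g e n t\<close> is the weight of shift \<open>n\<close> before move \<open>t\<close>, summed over all starting times
  and without the factor \<open>R ^ n\<close>, scaled by \<open>C ^ t\<close> to be an integer. The test \<open>n \<le> 2 * t\<close> ensures that
  the predicting bit has an index at least 1.
\<close>

primrec weight :: "nat \<Rightarrow> nat \<Rightarrow> nat \<Rightarrow> strategy \<Rightarrow> (nat \<Rightarrow> bool) \<Rightarrow> nat \<Rightarrow> nat \<Rightarrow> nat" where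
  "weight A B C g e n 0 = 0"
| "weight A B C g e n (Suc t) =
    (if n \<le> 2 * t
     then (weight A B C g e n t + C ^ t) * (if e t = play g e (2 * t + 1 - n) then B else A)
     else 0)"

text \<open>
  The votes are scaled by \<open>C ^ (2 * t)\<close> because \<open>R = (C - 1) / C\<close>; the summation index is the shift minus 1.
\<close>

definition vote :: "nat \<Rightarrow> nat \<Rightarrow> nat \<Rightarrow> strategy \<Rightarrow> (nat \<Rightarrow> bool) \<Rightarrow> bool \<Rightarrow> nat \<Rightarrow> nat" where
  "vote A B C g e b t = (\<Sum>n<2 * t. if play g e (2 * t - n) = b
     then (C - 1) ^ Suc n * C ^ (2 * t - Suc n) * (weight A B C g e (Suc n) t + C ^ t) else 0)"

definition minority :: "nat \<Rightarrow> nat \<Rightarrow> nat \<Rightarrow> strategy \<Rightarrow> (nat \<Rightarrow> bool) \<Rightarrow> nat \<Rightarrow> bool" where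
  "minority A B C g e t \<longleftrightarrow> vote A B C g e True t \<le> vote A B C g e False t"

text \<open>The past moves are stored as the binary digits of a single number.\<close>

primrec history :: "nat \<Rightarrow> nat \<Rightarrow> nat \<Rightarrow> strategy \<Rightarrow> nat \<Rightarrow> nat" where
  "history A B C g 0 = 0"
| "history A B C g (Suc t) = history A B C g t +
    of_bool (minority A B C g (bit (history A B C g t)) t) * 2 ^ t"

definition greedy :: "nat \<Rightarrow> nat \<Rightarrow> nat \<Rightarrow> strategy \<Rightarrow> nat \<Rightarrow> bool" where
  "greedy A B C g t = minority A B C g (bit (history A B C g t)) t"

section \<open>Decisions depend only on the past\<close>

text \<open>Move \<open>e t\<close> sits at position \<open>2 * t + 1\<close>, so positions up to
  \<open>2 * t\<close> involve only moves before it.\<close>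

lemma play_cong:
  assumes "\<And>i. i < t \<Longrightarrow> e i = e' i" "j \<le> 2 * t"
  shows "play g e j = play g e' j"
proof -
  have "map e [0..<j div 2] = map e' [0..<j div 2]"
    using assms(2) by (auto intro!: assms(1))
  moreover have "e (j div 2) = e' (j div 2)" if "odd j"
    using assms that by (intro assms(1)) (auto elim!: oddE)
  ultimately show ?thesis
    unfolding play_def by (simp del: map_eq_conv)
qed

text \<open>A positive shift keeps the predicting position strictly before the predicted
  move.\<close>

lemma weight_cong:
  assumes "\<And>i. i < t \<Longrightarrow> e i = e' i" "n > 0"
  shows "weight A B C g e n t = weight A B C g e' n t"
  using assms(1)
proof (induction t)
  case (Suc t)
  then have "play g e (2 * t + 1 - n) = play g e' (2 * t + 1 - n)"
    using assms(2) by (intro play_cong[of t]) auto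
  with Suc show ?case
    by simp
qed simp

lemma minority_cong:
  assumes "\<And>i. i < t \<Longrightarrow> e i = e' i"
  shows "minority A B C g e t = minority A B C g e' t"
  unfolding minority_def vote_def
  using weight_cong[of t e e', OF assms] play_cong[of t e e', OF assms]
  by (simp cong: if_cong)

text \<open>All digits from \<open>t\<close> on are still 0, so adding \<open>2 ^ t\<close> sets one
  digit without a carry.\<close>

lemma bit_history:
  includes bit_operations_syntax
  shows "bit (history A B C g t) i \<longleftrightarrow> i < t \<and> greedy A B C g i"
proof (induction t arbitrary: i)
  case (Suc t)
  have "history A B C g (Suc t) = history A B C g t OR of_bool (greedy A B C g t) * 2 ^ t"
    unfolding history.simps greedy_def[symmetric]
    by (subst disjunctive_add_eq_or[symmetric])
      (auto intro!: bit_eqI simp: bit_and_iff bit_exp_iff Suc)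
  then show ?case
    using Suc by (auto simp: bit_or_iff bit_exp_iff less_Suc_eq)
qed simp

text \<open>The stored digits agree with \<open>greedy\<close> before \<open>t\<close>, and the
  decision sees no more. This removes the coding from the weight argument.\<close>

lemma greedy_eq_minority: "greedy A B C g t = minority A B C g (greedy A B C g) t"
  unfolding greedy_def[of A B C g t] by (rule minority_cong) (simp add: bit_history)

section \<open>Computability of the strategy from \<open>g\<close>\<close>

lemma decidable_play [computable_intros]:
  assumes "computable (strategy_oracle g) k a" "computable (strategy_oracle g) k b"
  shows "decidable (strategy_oracle g) k (\<lambda>xs. play g (bit (a xs)) (b xs))"
proof -
  define code where "code h i = rec_nat 0 (\<lambda>l r. Suc (prod_encode (of_bool (bit h (i - Suc l)), r))) i"
    for h i :: nat
  \<comment> \<open>The list code is built from its last entry: after \<open>m\<close> rounds it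
    codes the final \<open>m\<close> of the \<open>i\<close> moves.\<close>
  have "rec_nat 0 (\<lambda>l r. Suc (prod_encode (of_bool (bit h (i - Suc l)), r))) m =
      list_encode (map (\<lambda>j. of_bool (bit h j)) [i - m..<i])" if "m \<le> i" for h i m :: nat
    using that
  proof (induction m)
    case (Suc m)
    then have "[i - Suc m..<i] = (i - Suc m) # [i - m..<i]"
      by (subst upt_conv_Cons) (auto simp: Suc_diff_Suc)
    with Suc show ?case
      by simp
  qed simp
  from this[of i i for i]
  have code: "code h i = list_encode (map (\<lambda>j. of_bool (bit h j)) [0..<i])" for h i
    unfolding code_def by simp
  have "computable (strategy_oracle g) 2 (\<lambda>ys. code (ys ! 0) (ys ! 1))"
    unfolding code_def by (intro computable_intros) auto
  note code_comp [computable_intros] = computable_comp2[OF this]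
  have ask: "strategy_oracle g (code h i) = of_bool (g (map (bit h) [0..<i]))" for h i
    unfolding strategy_oracle_def code by (simp add: comp_def)
  have play: "play g (bit h) j \<longleftrightarrow>
      (if odd j then bit h (j div 2) else 1 \<le> strategy_oracle g (code h (j div 2)))" for h j
    unfolding play_def ask by simp
  show ?thesis
    unfolding play by (intro computable_intros assms)
qed

lemma computable_weight [computable_intros]:
  assumes "computable (strategy_oracle g) k a" "computable (strategy_oracle g) k b"
    "computable (strategy_oracle g) k c"
  shows "computable (strategy_oracle g) k (\<lambda>xs. weight A B C g (bit (a xs)) (b xs) (c xs))"
proof -
  have eq: "weight A B C g e n t = rec_nat 0 (\<lambda>t r. if n \<le> 2 * t
     then (r + C ^ t) * (if e t = play g e (2 * t + 1 - n) then B else A) else 0) t" for e n t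
    by (induction t) auto
  have "computable (strategy_oracle g) 3 (\<lambda>ys. weight A B C g (bit (ys ! 0)) (ys ! 1) (ys ! 2))"
    unfolding eq by (intro computable_intros) auto
  from computable_comp3[of _ "\<lambda>h. weight A B C g (bit h)", OF this assms] show ?thesis .
qed

lemma decidable_minority:
  "decidable (strategy_oracle g) 2 (\<lambda>xs. minority A B C g (bit (xs ! 0)) (xs ! 1))"
  unfolding minority_def vote_def by (intro computable_intros) auto

lemma computable_from_greedy: "computable_from g (greedy A B C g)"
proof -
  note [computable_intros] =
    computable_comp2[OF decidable_minority[unfolded decidable_def], folded decidable_def]
  have "history A B C g t = rec_nat 0 (\<lambda>t r. r + of_bool (minority A B C g (bit r) t) * 2 ^ t) t" for t
    by (induction t) auto
  then have [computable_intros]: "computable (strategy_oracle g) 1 (\<lambda>xs. history A B C g (xs ! 0))"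
    by (simp only:) (intro computable_intros, auto)
  have "computable (strategy_oracle g) 1 (\<lambda>xs. of_bool (greedy A B C g (xs ! 0)))"
    unfolding greedy_def by (intro computable_intros) auto
  then obtain p where "\<forall>xs. length xs = 1 \<longrightarrow>
      computes (strategy_oracle g) p xs (of_bool (greedy A B C g (xs ! 0)))"
    unfolding computable_def by blast
  then have "computes (strategy_oracle g) p [n] (of_bool (greedy A B C g n))" for n
    by (metis length_Cons list.size(3) One_nat_def nth_Cons_0)
  then show ?thesis
    unfolding computable_from_def recursive_in_def by blast
qed

section \<open>The potential argument\<close>

text \<open>The left side is the weight of the single expert born at time \<open>s\<close>. Adding
  the newborn \<open>C ^ (s + p)\<close> on the right gives the bracket in the recursion of
  \<open>weight\<close> and covers \<open>p = 0\<close>.\<close>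

lemma weight_ge_prod:
  assumes "n \<le> 2 * s"
  shows "C ^ s * (\<Prod>i=s..<s + p. if e i = play g e (2 * i + 1 - n) then B else A)
    \<le> weight A B C g e n (s + p) + C ^ (s + p)"
proof (induction p)
  case (Suc p)
  then have "C ^ s * (\<Prod>i=s..<s + p. if e i = play g e (2 * i + 1 - n) then B else A) *
      (if e (s + p) = play g e (2 * (s + p) + 1 - n) then B else A)
    \<le> (weight A B C g e n (s + p) + C ^ (s + p)) *
      (if e (s + p) = play g e (2 * (s + p) + 1 - n) then B else A)"
    by (rule mult_right_mono) simp
  also have "\<dots> = weight A B C g e n (s + Suc p)"
    using assms by simp
  finally show ?case
    by (simp add: mult.assoc)
qed simp

text \<open>The total weight before move \<open>t\<close>, with the birth factor restored and the
  scaling \<open>C ^ t\<close> removed. Shifts beyond \<open>2 * t\<close> have weight 0.\<close>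

definition potential :: "nat \<Rightarrow> nat \<Rightarrow> nat \<Rightarrow> strategy \<Rightarrow> nat \<Rightarrow> real" where
  "potential A B C g t = (\<Sum>n<2 * t. (1 - 1 / real C) ^ Suc n *
     (real (weight A B C g (greedy A B C g) (Suc n) t) / real C ^ t))"

text \<open>Bounds the total weight of the experts born at one move.\<close>

lemma sum_geometric_le:
  assumes "C > 0"
  shows "(\<Sum>n<N. (1 - 1 / real C) ^ Suc n) \<le> real C"
proof -
  have "(\<Sum>n<N. (1 - 1 / real C) ^ n) * (1 / real C) = 1 - (1 - 1 / real C) ^ N"
    by (induction N) (auto simp: algebra_simps)
  also have "\<dots> \<le> 1"
    using assms by simp
  finally have "(\<Sum>n<N. (1 - 1 / real C) ^ n) \<le> real C"
    using assms by (simp add: field_simps)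
  moreover have "(\<Sum>n<N. (1 - 1 / real C) ^ Suc n) \<le> (\<Sum>n<N. (1 - 1 / real C) ^ n)"
    using assms by (intro sum_mono power_decreasing) auto
  ultimately show ?thesis
    by linarith
qed

text \<open>The experts gaining the factor \<open>B\<close> hold at most half the weight, newborns
  included, so the total grows by at most \<open>(A + B) / 2 \<le> C - 1\<close> before division by
  \<open>C\<close>.\<close>

lemma potential_Suc_le:
  assumes "A \<le> B" "A + B + 2 \<le> 2 * C"
  shows "potential A B C g (Suc t) \<le> (1 - 1 / real C) * (potential A B C g t + real C)"
proof -
  have C: "real C > 0"
    using assms by simp
  define R where "R = 1 - 1 / real C"
  define e where "e = greedy A B C g"
  \<comment> \<open>\<open>x n\<close> is the discounted weight of shift \<open>Suc n\<close> with
    its newborn, and \<open>L b\<close> the part of it predicting \<open>b\<close>.\<close>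
  define x where "x n = R ^ Suc n * (real (weight A B C g e (Suc n) t) + real C ^ t)" for n
  define L where "L b = (\<Sum>n<2 * t. if play g e (2 * t - n) = b then x n else 0)" for b
  have R: "R \<ge> 0" "R * C = real (C - 1)"
    using C by (auto simp: R_def field_simps of_nat_diff)
  \<comment> \<open>The votes are the sums \<open>L b\<close> with denominators cleared:
    \<open>Suc n \<le> 2 * t\<close> makes \<open>R ^ Suc n * C ^ (2 * t)\<close> an
    integer.\<close>
  have vote: "real (vote A B C g e b t) = real C ^ (2 * t) * L b" for b
  proof -
    have "real ((C - 1) ^ Suc n * C ^ (2 * t - Suc n)) = R ^ Suc n * C ^ (2 * t)" if "n < 2 * t" for n
    proof -
      have "real ((C - 1) ^ Suc n * C ^ (2 * t - Suc n)) = R ^ Suc n * (C ^ Suc n * C ^ (2 * t - Suc n))"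
        unfolding of_nat_mult of_nat_power R(2)[symmetric] power_mult_distrib by simp
      also have "C ^ Suc n * C ^ (2 * t - Suc n) = C ^ (2 * t)"
        using that by (subst power_add[symmetric]) simp
      finally show ?thesis
        by simp
    qed
    then have "real ((C - 1) ^ Suc n * C ^ (2 * t - Suc n) * (weight A B C g e (Suc n) t + C ^ t)) =
        real C ^ (2 * t) * x n" if "n < 2 * t" for n
      using that by (subst of_nat_mult) (simp add: x_def mult_ac del: power_Suc)
    then show ?thesis
      unfolding vote_def L_def of_nat_sum sum_distrib_left
      by (intro sum.cong) (auto simp del: power_Suc of_nat_mult of_nat_power)
  qed
  have "e t \<longleftrightarrow> vote A B C g e True t \<le> vote A B C g e False t"
    unfolding e_def by (subst greedy_eq_minority) (simp add: minority_def)
  also have "\<dots> \<longleftrightarrow> L True \<le> L False"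
    unfolding of_nat_le_iff[where 'a = real, symmetric] vote using C by simp
  finally have "L (e t) \<le> L (\<not> e t)"
    by (cases "e t") auto
  have L_sum: "L (e t) + L (\<not> e t) = (\<Sum>n<2 * t. x n)"
    unfolding L_def sum.distrib[symmetric] by (intro sum.cong) auto
  have weight_Suc: "R ^ Suc n * real (weight A B C g e (Suc n) (Suc t)) =
      real B * (if play g e (2 * t - n) = e t then x n else 0) +
      real A * (if play g e (2 * t - n) = (\<not> e t) then x n else 0)" if "n < 2 * t" for n
    using that by (auto simp: x_def simp del: power_Suc)
  have "real C ^ Suc t * potential A B C g (Suc t) =
      (\<Sum>n<2 * Suc t. R ^ Suc n * real (weight A B C g e (Suc n) (Suc t)))"
    unfolding potential_def sum_distrib_left e_def R_def
    using C by (intro sum.cong refl) (simp del: weight.simps power_Suc)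
  \<comment> \<open>The two new shifts \<open>2 * t + 1\<close> and \<open>2 * t + 2\<close> fail
    the test \<open>n \<le> 2 * t\<close> and contribute 0.\<close>
  also have "\<dots> = (\<Sum>n<2 * t. R ^ Suc n * real (weight A B C g e (Suc n) (Suc t)))"
    by simp
  also have "\<dots> = B * L (e t) + A * L (\<not> e t)"
    unfolding L_def sum_distrib_left sum.distrib[symmetric]
    by (intro sum.cong refl weight_Suc) simp
  also have "\<dots> \<le> (C - 1) * (L (e t) + L (\<not> e t))"
  proof -
    have "0 \<le> L b" for b
      unfolding L_def x_def using R(1) by (intro sum_nonneg) auto
    moreover have "real A + real B \<le> 2 * real (C - 1)"
      using assms by linarith
    ultimately have "(real A + real B) * (L (e t) + L (\<not> e t)) \<le> 2 * real (C - 1) * (L (e t) + L (\<not> e t))"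
      by (intro mult_right_mono add_nonneg_nonneg)
    moreover have "(real B - real A) * L (e t) \<le> (real B - real A) * L (\<not> e t)"
      using \<open>L (e t) \<le> L (\<not> e t)\<close> assms(1) by (intro mult_left_mono) auto
    ultimately show ?thesis
      by (simp add: algebra_simps)
  qed
  also have "L (e t) + L (\<not> e t) = real C ^ t * (potential A B C g t + (\<Sum>n<2 * t. R ^ Suc n))"
    unfolding L_sum unfolding x_def potential_def distrib_left sum_distrib_left sum.distrib[symmetric] e_def R_def
    using C by (intro sum.cong refl) (simp add: field_simps del: power_Suc)
  also have "real (C - 1) * \<dots> \<le> real (C - 1) * (real C ^ t * (potential A B C g t + real C))"
    using sum_geometric_le[of C "2 * t"] C unfolding R_def
    by (intro mult_left_mono add_left_mono) auto
  also have "\<dots> = real C ^ Suc t * (R * (potential A B C g t + real C))"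
    unfolding R(2)[symmetric] by simp
  finally show ?thesis
    using C unfolding R_def by (simp del: power_Suc)
qed

text \<open>The bound reproduces itself because
  \<open>(1 - 1 / C) * (C ^ 2 + C) = C ^ 2 - 1\<close>.\<close>

lemma potential_le:
  assumes "A \<le> B" "A + B + 2 \<le> 2 * C"
  shows "potential A B C g t \<le> real C ^ 2"
proof (induction t)
  case (Suc t)
  have "potential A B C g (Suc t) \<le> (1 - 1 / real C) * (potential A B C g t + real C)"
    using assms by (rule potential_Suc_le)
  also have "\<dots> \<le> (1 - 1 / real C) * (real C ^ 2 + real C)"
    using Suc assms by (intro mult_left_mono) auto
  also have "\<dots> \<le> real C ^ 2"
    using assms by (simp add: field_simps power2_eq_square)
  finally show ?case .
qed (simp add: potential_def)

text \<open>The left side is the weight at time \<open>s + p\<close> of the expert with shift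
  \<open>n\<close> born at \<open>s\<close>. It is bounded by the potential, plus 1 for the newborn
  of that shift.\<close>

lemma greedy_mismatches:
  fixes A B C n s p :: nat and g :: strategy
  defines "X \<equiv> card {i \<in> {s..<s + p}. greedy A B C g i \<noteq> play g (greedy A B C g) (2 * i + 1 - n)}"
  assumes "A \<le> B" "A + B + 2 \<le> 2 * C" "0 < n" "n \<le> 2 * s"
  shows "(1 - 1 / real C) ^ n * ((A / C) ^ X * (B / C) ^ (p - X)) \<le> real C ^ 2 + 1"
proof -
  define e where "e = greedy A B C g"
  define I where "I = {i \<in> {s..<s + p}. e i \<noteq> play g e (2 * i + 1 - n)}"
  have C: "real C > 0"
    using assms by simp
  have I: "I \<subseteq> {s..<s + p}" and X: "X = card I"
    by (auto simp: I_def X_def e_def)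
  have "{s..<s + p} \<inter> {i. e i = play g e (2 * i + 1 - n)} = {s..<s + p} - I"
    "{s..<s + p} \<inter> - {i. e i = play g e (2 * i + 1 - n)} = I"
    by (auto simp: I_def)
  moreover have "card ({s..<s + p} - I) = p - X"
    using I X by (simp add: card_Diff_subset finite_subset)
  moreover have "X \<le> p"
    using card_mono[OF _ I] X by simp
  ultimately have "(\<Prod>i=s..<s + p. if e i = play g e (2 * i + 1 - n) then B else A) = A ^ X * B ^ (p - X)"
    using X by (subst prod.If_cases) auto
  then have "C ^ s * (A ^ X * B ^ (p - X)) \<le> weight A B C g e n (s + p) + C ^ (s + p)"
    using weight_ge_prod[OF \<open>n \<le> 2 * s\<close>, of C e g B A p] by simp
  then have "real (C ^ s * (A ^ X * B ^ (p - X))) / real C ^ (s + p)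
      \<le> real (weight A B C g e n (s + p) + C ^ (s + p)) / real C ^ (s + p)"
    by (intro divide_right_mono of_nat_mono) auto
  moreover have "real (C ^ s * (A ^ X * B ^ (p - X))) / real C ^ (s + p) = (A / C) ^ X * (B / C) ^ (p - X)"
    using C \<open>X \<le> p\<close> by (simp add: power_divide power_add[symmetric] field_simps)
  moreover have "real (weight A B C g e n (s + p) + C ^ (s + p)) / real C ^ (s + p)
      = weight A B C g e n (s + p) / real C ^ (s + p) + 1"
    using C by (simp add: field_simps)
  ultimately have "(A / C) ^ X * (B / C) ^ (p - X) \<le> weight A B C g e n (s + p) / real C ^ (s + p) + 1"
    by simp
  then have "(1 - 1 / real C) ^ n * ((A / C) ^ X * (B / C) ^ (p - X))
      \<le> (1 - 1 / real C) ^ n * (weight A B C g e n (s + p) / real C ^ (s + p) + 1)"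
    using C assms by (intro mult_left_mono) auto
  also have "\<dots> \<le> (1 - 1 / real C) ^ n * (weight A B C g e n (s + p) / real C ^ (s + p)) + 1"
    using C assms by (auto simp: distrib_left intro!: power_le_one)
  also have "(1 - 1 / real C) ^ n * (weight A B C g e n (s + p) / real C ^ (s + p))
      \<le> potential A B C g (s + p)"
    unfolding potential_def e_def
    using member_le_sum[of "n - 1" "{..<2 * (s + p)}" "\<lambda>n. (1 - 1 / real C) ^ Suc n *
      (real (weight A B C g (greedy A B C g) (Suc n) (s + p)) / real C ^ (s + p))"] C assms
    by (auto simp del: power_Suc)
  also have "\<dots> \<le> real C ^ 2"
    using assms by (intro potential_le)
  finally show ?thesis
    by simp
qed

text \<open>
  With \<open>x = 1 / m\<close> the rates are \<open>A / B = 1 - x\<close> and \<open>C / B = 1 - x / 2 + x\<^sup>2 / 2\<close>, just above the mean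
  of \<open>A / B\<close> and 1; then the logarithmic growth rate is \<open>\<epsilon> * x\<close> to first order.
\<close>

lemma exists_rates:
  fixes \<epsilon> :: real
  assumes "\<epsilon> > 0"
  obtains A B C :: nat where "0 < A" "A < B" "C < B" "A + B + 2 \<le> 2 * C"
    "ln (1 - 1 / real C) + (1 / 4 - \<epsilon>) * ln (A / B) + ln (B / C) / 2 > 0"
proof -
  \<comment> \<open>Clearing denominators gives \<open>B = 2 * m ^ 2\<close>,
    \<open>A = 2 * m ^ 2 - 2 * m\<close> and \<open>C = c m\<close>, so that
    \<open>A + B + 2 = 2 * C\<close>.\<close>
  define c where "c x = 2 * x ^ 2 - x + 1" for x :: real
  define rate where "rate x = ln (1 - 1 / c x) + (1 / 4 - \<epsilon>) * ln ((2 * x ^ 2 - 2 * x) / (2 * x ^ 2)) +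
    ln (2 * x ^ 2 / c x) / 2" for x :: real
  \<comment> \<open>The three logarithms contribute 0, \<open>\<epsilon> - 1 / 4\<close> and
    \<open>1 / 4\<close> in the limit.\<close>
  have "((\<lambda>m. real m * rate (real m)) \<longlongrightarrow> \<epsilon>) sequentially"
    unfolding rate_def c_def by real_asymp
  then have "eventually (\<lambda>m. real m * rate (real m) > 0) sequentially"
    using assms by (rule order_tendstoD)
  then have "eventually (\<lambda>m. m \<ge> 2 \<and> rate (real m) > 0) sequentially"
    using eventually_ge_at_top[of 2] by eventually_elim (auto simp: zero_less_mult_iff)
  then obtain m :: nat where m: "m \<ge> 2" "rate (real m) > 0"
    by (auto simp: eventually_sequentially)
  have sq: "m ^ 2 \<ge> 2 * m"
    using m(1) by (simp add: power2_eq_square)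
  have "real (2 * m ^ 2 - m + 1) = c (real m)" "real (2 * m ^ 2 - 2 * m) = 2 * real m ^ 2 - 2 * real m"
    "real (2 * m ^ 2) = 2 * real m ^ 2"
    using sq by (auto simp: c_def of_nat_diff)
  note of_nat = this
  show thesis
  proof (rule that[of "2 * m ^ 2 - 2 * m" "2 * m ^ 2" "2 * m ^ 2 - m + 1"])
    show "ln (1 - 1 / real (2 * m ^ 2 - m + 1)) + (1 / 4 - \<epsilon>) *
        ln (real (2 * m ^ 2 - 2 * m) / real (2 * m ^ 2)) + ln (real (2 * m ^ 2) / real (2 * m ^ 2 - m + 1)) / 2 > 0"
      using m(2) unfolding rate_def of_nat .
    have "2 * M - 2 * m + 2 * M + 2 \<le> 2 * (2 * M - m + 1)" if "2 * m \<le> M" for M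
      using that by presburger
    from this[OF sq] show "2 * m ^ 2 - 2 * m + 2 * m ^ 2 + 2 \<le> 2 * (2 * m ^ 2 - m + 1)" .
  qed (use sq m(1) in \<open>linarith+\<close>)
qed

section \<open>From the weight bound to adjacent blocks\<close>

theorem theorem5p9:
  fixes \<epsilon> :: real
  assumes "\<epsilon> > 0"
  shows "\<exists>N::nat. \<forall>g :: strategy. \<exists>e :: nat \<Rightarrow> bool.
    computable_from g e \<and>
    (\<forall>k\<ge>1. \<forall>n>N.
      real (card {s. s < n \<and> play g e (k + s) \<noteq> play g e (k + n + s)})
        \<ge> real n * (1 / 4 - \<epsilon>))"
proof -
  obtain A B C :: nat where ABC: "0 < A" "A < B" "C < B" "A + B + 2 \<le> 2 * C"
    and pos: "ln (1 - 1 / real C) + (1 / 4 - \<epsilon>) * ln (A / B) + ln (B / C) / 2 > 0"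
    using exists_rates[OF assms] .
  \<comment> \<open>Growth of the log-weight per unit of \<open>n\<close>, for \<open>n / 2\<close>
    moves with \<open>n * (1 / 4 - \<epsilon>)\<close> mismatches.\<close>
  define \<gamma> where "\<gamma> = ln (1 - 1 / real C) + (1 / 4 - \<epsilon>) * ln (A / B) + ln (B / C) / 2"
  \<comment> \<open>Beyond \<open>N\<close> this growth exceeds the bound
    \<open>ln (C ^ 2 + 1)\<close> plus a loss of half a move when \<open>n\<close> is odd.\<close>
  define N where "N = nat \<lceil>(ln (real C ^ 2 + 1) + ln (B / C) / 2) / \<gamma>\<rceil>"
  have N: "real n * \<gamma> > ln (real C ^ 2 + 1) + ln (B / C) / 2" if "n > N" for n
  proof -
    have "(ln (real C ^ 2 + 1) + ln (B / C) / 2) / \<gamma> < n"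
      using that unfolding N_def by linarith
    then show ?thesis
      using pos unfolding \<gamma>_def[symmetric] by (simp add: field_simps)
  qed
  have "real n * (1 / 4 - \<epsilon>)
      \<le> card {s. s < n \<and> play g (greedy A B C g) (k + s) \<noteq> play g (greedy A B C g) (k + n + s)}"
    if "k \<ge> 1" "n > N" for g k n
  proof -
    define e where "e = greedy A B C g"
    \<comment> \<open>Move \<open>s\<close> is Player 1's first in the second block, which starts at
      position \<open>k + n\<close>; at least \<open>p\<close> of the moves from \<open>s\<close> on
      fit into it.\<close>
    define s where "s = (k + n) div 2"
    define p where "p = n div 2"
    define I where "I = {i \<in> {s..<s + p}. e i \<noteq> play g e (2 * i + 1 - n)}"
    have s: "k + n \<le> 2 * i + 1" "2 * i + 1 < k + n + n" if "i \<in> {s..<s + p}" for i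
      using that \<open>k \<ge> 1\<close> unfolding s_def p_def by auto
    have "n \<le> 2 * s"
      using \<open>k \<ge> 1\<close> unfolding s_def by linarith
    then have bound: "(1 - 1 / real C) ^ n * ((A / C) ^ card I * (B / C) ^ (p - card I)) \<le> real C ^ 2 + 1"
      unfolding I_def e_def using ABC \<open>n > N\<close> by (intro greedy_mismatches) auto
    have "I \<subseteq> {s..<s + p}"
      by (auto simp: I_def)
    then have "card I \<le> p"
      using card_mono[of "{s..<s + p}" I] by simp
    \<comment> \<open>Each mismatching move is sent to its offset in the second block.\<close>
    have "card I \<le> card {s. s < n \<and> play g e (k + s) \<noteq> play g e (k + n + s)}"
    proof (rule card_inj_on_le)
      show "inj_on (\<lambda>i. 2 * i + 1 - (k + n)) I"
        unfolding I_def using s by (intro inj_onI) force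
      show "(\<lambda>i. 2 * i + 1 - (k + n)) ` I \<subseteq> {s. s < n \<and> play g e (k + s) \<noteq> play g e (k + n + s)}"
      proof (intro subsetI, elim imageE)
        fix j i
        assume j: "j = 2 * i + 1 - (k + n)" and "i \<in> I"
        then have "e i \<noteq> play g e (2 * i + 1 - n)" and i: "i \<in> {s..<s + p}"
          by (auto simp: I_def)
        moreover have "k + n + j = 2 * i + 1" "k + j = 2 * i + 1 - n" "j < n"
          using s[OF i] j by auto
        moreover have "play g e (2 * i + 1) = e i"
          by (simp add: play_def)
        ultimately show "j \<in> {s. s < n \<and> play g e (k + s) \<noteq> play g e (k + n + s)}"
          by simp
      qed
    qed simp
    moreover have "real n * (1 / 4 - \<epsilon>) \<le> card I"
    proof (rule ccontr)
      assume less: "\<not> real n * (1 / 4 - \<epsilon>) \<le> card I"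
      have *: "real C > 1" "real A > 0" "real B > real C"
        using ABC by auto
      have "ln ((1 - 1 / real C) ^ n * ((A / C) ^ card I * (B / C) ^ (p - card I)))
          = n * ln (1 - 1 / real C) + (card I * ln (A / C) + real (p - card I) * ln (B / C))"
        using * by (simp add: ln_mult ln_realpow)
      \<comment> \<open>Each mismatch replaces a factor \<open>B / C\<close> by
        \<open>A / C\<close>, at cost \<open>ln (A / B)\<close>.\<close>
      also have "\<dots> = n * ln (1 - 1 / real C) + (card I * ln (A / B) + p * ln (B / C))"
        using * \<open>card I \<le> p\<close> by (simp add: ln_div of_nat_diff algebra_simps)
      finally have "n * ln (1 - 1 / real C) + (card I * ln (A / B) + p * ln (B / C)) =
          ln ((1 - 1 / real C) ^ n * ((A / C) ^ card I * (B / C) ^ (p - card I)))"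
        by simp
      also have "\<dots> \<le> ln (real C ^ 2 + 1)"
        using bound * by (intro ln_le_cancel_iff[THEN iffD2]) (auto intro!: mult_pos_pos add_pos_pos)
      finally have "n * ln (1 - 1 / real C) + (card I * ln (A / B) + p * ln (B / C)) \<le> ln (real C ^ 2 + 1)" .
      \<comment> \<open>As \<open>ln (A / B) < 0\<close>, fewer mismatches mean a larger
        weight.\<close>
      moreover have "real n * (1 / 4 - \<epsilon>) * ln (A / B) \<le> card I * ln (A / B)"
        using less * ABC by (intro mult_right_mono_neg) auto
      moreover have "(real n - 1) / 2 * ln (B / C) \<le> p * ln (B / C)"
        using * by (intro mult_right_mono) (auto simp: p_def)
      ultimately have "n * \<gamma> \<le> ln (real C ^ 2 + 1) + ln (B / C) / 2"
        unfolding \<gamma>_def by (simp add: algebra_simps diff_divide_distrib)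
      with N[OF \<open>n > N\<close>] show False
        by simp
    qed
    ultimately show ?thesis
      unfolding e_def by linarith
  qed
  then show ?thesis
    using computable_from_greedy by blast
qed

end
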